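(* Let $\beta$ be a Salem number with minimal polynomial $P(x) = x^6 + ax^5 + bx^4 + cx^3 + bx^2 + ax + 1$, where $a,b,c\in\mathbb{Z}$. Then $\beta \in P_{1,7} \cap C_{x^2+1}$ (that is, $d_\beta(1)$ is eventually periodic with preperiod length $1$ and period length $7$, and the co-factor of $\beta$ is $x^2+1$) if and only if all of the following hold: (i) $b \leq -1$; (ii) $1 \leq c \leq -a$; (iii) $a \leq 2b$; (iv) if $a = 2b$ then $1 \leq b + c$.
   Context: A Salem number is a real algebraic integer $\beta>1$ whose other Galois conjugates all satisfy $|\alpha|\le 1$, with at least one satisfying $|\alpha|=1$. For real $\beta>1$, the greedy beta expansion $d_\beta(1)=(c_n)_{n\ge1}$ is defined by $r_0=1$, and for $n\ge 1$: $c_n=\lfloor \beta r_{n-1}\rfloor$, $r_n=\beta r_{n-1}-\lfloor \beta r_{n-1}\rfloor$. If it is eventually periodic, $\beta$ is called a Parry number, and the smallest $m\ge0$ and $p\ge1$ with $c_{n+m}=c_{n+m+p}$ for all $n\ge1$ are the preperiod length and the period length of the expansion. (By convention $p=0$ if $r_N=0$ for some $N$; this never happens for Salem numbers.) For a Salem number $\beta$ that is a Parry number with preperiod length $m$ and period length $p\geq 1$, put $P_k(x)=x^k-c_1x^{k-1}-\dots-c_k$. The companion polynomial is $R(x)=P_{m+p}(x)-P_m(x)$; it has $\beta$ as a root, so $R(x)=P(x)Q(x)$ with $P$ the minimal polynomial of $\beta$ and $Q\in\mathbb{Z}[x]$; $Q$ is the co-factor of $\beta$. $P_{m,p}$ denotes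 the set of Salem Parry numbers whose beta expansion $d_\beta(1)$ has preperiod length $m$ and period length $p$. $C_{Q(x)}$ denotes the set of all Salem (Parry) numbers whose co-factor is $Q(x)$. *)

theory Defs
  imports Complex_Main "HOL-Computational_Algebra.Polynomial"
    "HOL-Computational_Algebra.Polynomial_Factorial"
begin

definition is_minimal_polynomial :: "rat poly \<Rightarrow> 'a::field_char_0 \<Rightarrow> bool" where
  "is_minimal_polynomial p x \<longleftrightarrow>
     lead_coeff p = 1 \<and> irreducible p \<and> poly (map_poly of_rat p) x = 0"

text \<open>The minimal polynomial of an algebraic integer has integer coefficients; it is
  characterised here as a polynomial over the integers whose image over the rationals is
  the minimal polynomial.\<close>

definition is_minimal_int_polynomial :: "int poly \<Rightarrow> 'a::field_char_0 \<Rightarrow> bool" where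
  "is_minimal_int_polynomial p x \<longleftrightarrow> is_minimal_polynomial (map_poly of_int p) x"

definition galois_conjugates :: "real \<Rightarrow> complex set" where
  "galois_conjugates x =
     {z. \<exists>p. is_minimal_polynomial p x \<and> poly (map_poly of_rat p) z = 0}"

definition salem_number :: "real \<Rightarrow> bool" where
  "salem_number \<beta> \<longleftrightarrow>
     algebraic_int \<beta> \<and> \<beta> > 1 \<and>
     (\<forall>z\<in>galois_conjugates \<beta> - {of_real \<beta>}. cmod z \<le> 1) \<and>
     (\<exists>z\<in>galois_conjugates \<beta> - {of_real \<beta>}. cmod z = 1)"

fun beta_remainder :: "real \<Rightarrow> nat \<Rightarrow> real" where
  "beta_remainder \<beta> 0 = 1"
| "beta_remainder \<beta> (Suc n) =
     \<beta> * beta_remainder \<beta> n - of_int \<lfloor>\<beta> * beta_remainder \<beta> n\<rfloor>"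

text \<open>Digits are indexed from 1; the value at index 0 is never used.\<close>

definition beta_digit :: "real \<Rightarrow> nat \<Rightarrow> int" where
  "beta_digit \<beta> n = \<lfloor>\<beta> * beta_remainder \<beta> (n - 1)\<rfloor>"

definition beta_periodic_from :: "real \<Rightarrow> nat \<Rightarrow> nat \<Rightarrow> bool" where
  "beta_periodic_from \<beta> m p \<longleftrightarrow>
     (\<forall>n\<ge>1. beta_digit \<beta> (n + m) = beta_digit \<beta> (n + m + p))"

definition parry_number :: "real \<Rightarrow> bool" where
  "parry_number \<beta> \<longleftrightarrow> \<beta> > 1 \<and> (\<exists>m. \<exists>p\<ge>1. beta_periodic_from \<beta> m p)"

text \<open>The following two values are meaningful only for Parry numbers. The preperiod length
  is minimal among all admissible period lengths; a finite expansion has period length 0 by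
  convention.\<close>

definition preperiod_length :: "real \<Rightarrow> nat" where
  "preperiod_length \<beta> = (LEAST m. \<exists>p\<ge>1. beta_periodic_from \<beta> m p)"

definition period_length :: "real \<Rightarrow> nat" where
  "period_length \<beta> =
     (if \<exists>N. beta_remainder \<beta> N = 0 then 0
      else LEAST p. p \<ge> 1 \<and> beta_periodic_from \<beta> (preperiod_length \<beta>) p)"

definition beta_poly :: "real \<Rightarrow> nat \<Rightarrow> int poly" where
  "beta_poly \<beta> k = monom 1 k - (\<Sum>i=1..k. monom (beta_digit \<beta> i) (k - i))"

definition companion_polynomial :: "real \<Rightarrow> int poly" where
  "companion_polynomial \<beta> =
     beta_poly \<beta> (preperiod_length \<beta> + period_length \<beta>) - beta_poly \<beta> (preperiod_length \<beta>)"

definition is_cofactor :: "int poly \<Rightarrow> real \<Rightarrow> bool" where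
  "is_cofactor Q \<beta> \<longleftrightarrow>
     (\<exists>P. is_minimal_int_polynomial P \<beta> \<and> companion_polynomial \<beta> = P * Q)"

definition salem_parry_numbers :: "nat \<Rightarrow> nat \<Rightarrow> real set" where
  "salem_parry_numbers m p =
     {\<beta>. salem_number \<beta> \<and> parry_number \<beta> \<and> preperiod_length \<beta> = m \<and> period_length \<beta> = p}"

definition salem_parry_with_cofactor :: "int poly \<Rightarrow> real set" where
  "salem_parry_with_cofactor Q =
     {\<beta>. salem_number \<beta> \<and> parry_number \<beta> \<and> period_length \<beta> \<ge> 1 \<and> is_cofactor Q \<beta>}"

end

theory Submission
  imports Defs "HOL-Computational_Algebra.Field_as_Ring"
begin

text \<open>Expanding \<open>(x\<^sup>2 + 1) P(x)\<close> and comparing it with \<open>P\<^sub>8(x) - P\<^sub>1(x)\<close> shows that the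
  expansion must be \<open>-a\<close> followed by the period
  \<open>-b-1, -a-c, -2b, -a-c, -b-1, -a-1, -a-1\<close>. The stated inequalities say that these digits
  are nonnegative and that every proper shift of the sequence is lexicographically smaller than
  the sequence itself, which is Parry's characterisation of greedy expansions of \<open>1\<close>.\<close>

section \<open>Uniqueness of minimal polynomials\<close>

lemma map_poly_of_rat_add:
  "map_poly (of_rat :: rat \<Rightarrow> 'a::field_char_0) (p + q) = map_poly of_rat p + map_poly of_rat q"
  by (intro poly_eqI) (simp add: coeff_map_poly of_rat_add)

lemma map_poly_of_rat_mult:
  "map_poly (of_rat :: rat \<Rightarrow> 'a::field_char_0) (p * q) = map_poly of_rat p * map_poly of_rat q"
  by (intro poly_eqI) (simp add: coeff_map_poly coeff_mult of_rat_sum of_rat_mult)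

text \<open>An irreducible \<open>p\<close> not dividing \<open>q\<close> is coprime to it over the
  rationals; evaluating the Bezout identity at the common root \<open>x\<close> gives 0 = 1.\<close>

lemma minimal_polynomial_dvd:
  fixes x :: "'a::field_char_0"
  assumes "is_minimal_polynomial p x" and "poly (map_poly of_rat q) x = 0"
  shows "p dvd q"
proof (rule ccontr)
  assume ndvd: "\<not> p dvd q"
  from assms have "irreducible p" "poly (map_poly of_rat p) x = 0"
    by (auto simp: is_minimal_polynomial_def)
  then have "prime_elem p"
    by (simp add: irreducible_imp_prime_elem)
  with ndvd have "coprime p q"
    by (simp add: prime_elem_imp_coprime)
  then obtain u v where "u * p + v * q = 1"
    by (metis bezout_coefficients_fst_snd coprime_imp_gcd_eq_1)
  then have "poly (map_poly of_rat (u * p + v * q)) x = 1"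
    by (simp add: map_poly_1)
  then show False
    using assms(2) \<open>poly (map_poly of_rat p) x = 0\<close>
    by (simp add: map_poly_of_rat_add map_poly_of_rat_mult)
qed

lemma minimal_polynomial_unique:
  fixes x :: "'a::field_char_0"
  assumes "is_minimal_polynomial p x" and "is_minimal_polynomial q x"
  shows "p = q"
proof -
  have "p dvd q" "q dvd p"
    using assms by (auto intro: minimal_polynomial_dvd simp: is_minimal_polynomial_def)
  moreover have "unit_factor p = 1" "unit_factor q = 1"
    using assms by (simp_all add: is_minimal_polynomial_def unit_factor_poly_def one_pCons)
  then have "normalize p = p" "normalize q = q"
    by (metis mult_1 unit_factor_mult_normalize)+
  ultimately show ?thesis
    by (metis associatedI)
qed

text \<open>\<open>is_cofactor\<close> supplies some minimal polynomial; this identifies it with the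
  given palindromic one.\<close>

lemma minimal_int_polynomial_unique:
  fixes x :: "'a::field_char_0"
  assumes "is_minimal_int_polynomial p x" and "is_minimal_int_polynomial q x"
  shows "p = q"
proof -
  have "map_poly (of_int :: int \<Rightarrow> rat) p = map_poly of_int q"
    using assms minimal_polynomial_unique unfolding is_minimal_int_polynomial_def by blast
  then show ?thesis
    by (simp add: poly_eq_iff coeff_map_poly)
qed

section \<open>Greedy expansions of 1\<close>

text \<open>A remainder \<open>r (Suc n)\<close> in [0,1) makes \<open>e n\<close> the floor of
  \<open>\<beta> * r n\<close>. The start \<open>r 0 = 1\<close> lies outside [0,1), so only
  successors are bounded.\<close>

lemma beta_expansion_unique:
  fixes r :: "nat \<Rightarrow> real" and e :: "nat \<Rightarrow> int"
  assumes "r 0 = 1"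
    and rec: "\<And>n. r (Suc n) = \<beta> * r n - of_int (e n)"
    and bounds: "\<And>n. 0 \<le> r (Suc n) \<and> r (Suc n) < 1"
  shows "beta_remainder \<beta> n = r n" and "beta_digit \<beta> (Suc n) = e n"
proof -
  have floor: "\<lfloor>\<beta> * r n\<rfloor> = e n" for n
    using bounds[of n] rec[of n] by (intro floor_unique) linarith+
  show rem: "beta_remainder \<beta> n = r n" for n
    by (induction n) (simp_all add: assms(1) rec floor)
  show "beta_digit \<beta> (Suc n) = e n"
    by (simp add: beta_digit_def rem floor)
qed

lemma beta_remainder_le_1: "beta_remainder \<beta> n \<le> 1"
proof (cases n)
  case (Suc k)
  then show ?thesis
    using floor_correct[of "\<beta> * beta_remainder \<beta> k"] by simp linarith
qed simp

lemma beta_remainder_nonneg: "0 \<le> beta_remainder \<beta> n"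
  by (cases n) simp_all

lemma beta_digit_nonneg: "0 \<le> \<beta> \<Longrightarrow> 0 \<le> beta_digit \<beta> n"
  by (simp add: beta_digit_def beta_remainder_nonneg)

lemma beta_digit_le_first: "0 \<le> \<beta> \<Longrightarrow> beta_digit \<beta> n \<le> beta_digit \<beta> 1"
  by (simp add: beta_digit_def floor_mono beta_remainder_le_1 mult_left_le)

text \<open>Removing the same digit from \<open>\<beta> * r\<close> with \<open>r\<close> at most 1
  leaves at most the first remainder, and the floor is monotone. With
  \<open>beta_digit_le_first\<close> this is the part of Parry's condition behind the necessity of
  the inequalities.\<close>

lemma beta_digit_le_second:
  assumes "0 \<le> \<beta>" and "1 \<le> n" and "beta_digit \<beta> n = beta_digit \<beta> 1"
  shows "beta_digit \<beta> (Suc n) \<le> beta_digit \<beta> 2"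
proof -
  obtain k where n: "n = Suc k"
    using assms(2) by (cases n) auto
  have "beta_remainder \<beta> (Suc k) \<le> beta_remainder \<beta> 1"
    using assms beta_remainder_le_1[of \<beta> k] unfolding n beta_digit_def
    by (simp add: mult_left_le)
  then show ?thesis
    using assms(1) unfolding n beta_digit_def
    by (simp add: numeral_2_eq_2 floor_mono mult_left_mono)
qed

text \<open>The first disagreement with the initial digits makes \<open>r n - 1\<close> at most \<open>1/\<beta>\<close> times a later value
  of the same form, so the supremum of \<open>r\<close> cannot exceed 1.\<close>

lemma parry_criterion:
  fixes r :: "nat \<Rightarrow> real" and e :: "nat \<Rightarrow> int"
  assumes \<beta>: "\<beta> > 1" and r0: "r 0 = 1"
    and rec: "\<And>n. r (Suc n) = \<beta> * r n - of_int (e n)"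
    and bounded: "\<And>n. \<bar>r n\<bar> \<le> B"
    and nonneg: "\<And>n. 0 \<le> e n"
    and infinite: "\<And>n. \<exists>k\<ge>n. 0 < e k"
    and lex: "\<And>n. n \<ge> 1 \<Longrightarrow> \<exists>k. (\<forall>j<k. e (n + j) = e j) \<and> e (n + k) < e k"
  shows "0 < r n" and "n \<ge> 1 \<Longrightarrow> r n < 1"
proof -
  have r_nonneg: "0 \<le> r n" for n
  proof (rule ccontr)
    assume "\<not> 0 \<le> r n"
    \<comment> \<open>Nonnegative digits only lower the remainder, so a negative one would diverge
      at least like \<open>\<beta> ^ k\<close>, against the bound \<open>B\<close>.\<close>
    have pow: "- B \<le> \<beta> ^ k * r n" for k n
    proof (induction k arbitrary: n)
      case 0
      then show ?case
        using bounded[of n] by simp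
    next
      case (Suc k)
      have "- B \<le> \<beta> ^ k * r (Suc n)"
        by (rule Suc)
      also have "\<dots> \<le> \<beta> ^ k * (\<beta> * r n)"
        using \<beta> nonneg[of n] by (intro mult_left_mono) (simp_all add: rec)
      finally show ?case
        by (simp add: mult_ac)
    qed
    obtain k where "B / (- r n) < \<beta> ^ k"
      using real_arch_pow[OF \<beta>] by blast
    then show False
      using pow[of k n] \<open>\<not> 0 \<le> r n\<close> by (simp add: field_simps)
  qed
  show r_pos: "0 < r n" for n
  proof (rule ccontr)
    assume "\<not> 0 < r n"
    then have "r n = 0"
      using r_nonneg[of n] by simp
    \<comment> \<open>Zero is absorbing, so one zero remainder would kill all later digits.\<close>
    have step: "e m = 0 \<and> r (Suc m) = 0" if "r m = 0" for m
      using rec[of m] r_nonneg[of "Suc m"] nonneg[of m] that by simp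
    have "r (n + j) = 0" for j
      by (induction j) (simp_all add: \<open>r n = 0\<close> step)
    then have "e k = 0" if "k \<ge> n" for k
      using step that by (metis le_add_diff_inverse)
    then show False
      using infinite[of n] by auto
  qed
  \<comment> \<open>While the digits agree, both orbits follow the same affine map, which scales
    their difference by \<open>\<beta>\<close>.\<close>
  have expand: "\<beta> ^ k * (r n - 1) = r (n + k) - r k" if "\<forall>j<k. e (n + j) = e j" for n k
    using that
  proof (induction k)
    case (Suc k)
    then have "\<beta> ^ Suc k * (r n - 1) = \<beta> * (r (n + k) - r k)"
      by simp
    with Suc.prems show ?case
      by (simp add: rec algebra_simps)
  qed (simp add: r0)
  have lt: "\<exists>k. \<beta> ^ Suc k * (r n - 1) < r (n + Suc k) - 1" if "n \<ge> 1" for n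
  proof -
    obtain k where k: "\<forall>j<k. e (n + j) = e j" "e (n + k) < e k"
      using lex \<open>n \<ge> 1\<close> by blast
    have "\<beta> ^ Suc k * (r n - 1) = \<beta> * (r (n + k) - r k)"
      using expand[OF k(1)] by simp
    also have "\<dots> = r (n + Suc k) - r (Suc k) + of_int (e (n + k) - e k)"
      by (simp add: rec algebra_simps)
    also have "\<dots> < r (n + Suc k) - 1"
      using k(2) r_pos[of "Suc k"] by linarith
    finally show ?thesis ..
  qed
  define M where "M = (SUP n. r n)"
  have "bdd_above (range r)"
    using bounded by (intro bdd_aboveI[of _ B]) (auto dest: abs_le_D1)
  then have le_M: "r n \<le> M" for n
    unfolding M_def by (simp add: cSUP_upper)
  have "1 \<le> M"
    using le_M[of 0] r0 by simp
  have "r n \<le> 1 + (M - 1) / \<beta>" for n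
  proof (cases "n = 0 \<or> r n \<le> 1")
    case True
    then show ?thesis
      using \<beta> \<open>1 \<le> M\<close> r0 by (auto intro: order_trans[of _ 1])
  next
    case False
    then obtain k where "\<beta> ^ Suc k * (r n - 1) < r (n + Suc k) - 1"
      using lt[of n] by auto
    moreover have "\<beta> * (r n - 1) \<le> \<beta> ^ Suc k * (r n - 1)"
      using \<beta> False by (intro mult_right_mono) (simp_all add: one_le_power)
    ultimately have "\<beta> * (r n - 1) \<le> M - 1"
      using le_M[of "n + Suc k"] by linarith
    then show ?thesis
      using \<beta> by (simp add: field_simps)
  qed
  then have "M \<le> 1 + (M - 1) / \<beta>"
    unfolding M_def by (intro cSUP_least) auto
  then have "(\<beta> - 1) * (M - 1) \<le> 0"
    using \<beta> by (simp add: field_simps)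
  then have "M \<le> 1"
    using \<beta> by (simp add: mult_le_0_iff)
  \<comment> \<open>Strictness in \<open>lt\<close>, which comes from \<open>0 < r (Suc k)\<close>,
    sharpens the bound 1 to a strict one.\<close>
  show "r n < 1" if "n \<ge> 1"
  proof -
    obtain k where "\<beta> ^ Suc k * (r n - 1) < r (n + Suc k) - 1"
      using lt \<open>n \<ge> 1\<close> by blast
    then have "\<beta> ^ Suc k * (r n - 1) < 0"
      using le_M[of "n + Suc k"] \<open>M \<le> 1\<close> by linarith
    then show ?thesis
      using \<beta> by (simp add: mult_less_0_iff)
  qed
qed

section \<open>Preperiod 1 and period 7\<close>

lemma beta_poly_0: "beta_poly \<beta> 0 = 1"
  by (simp add: beta_poly_def monom_0 one_pCons)

text \<open>The Horner recursion, which computes \<open>beta_poly\<close> at a concrete index as a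
  coefficient list.\<close>

lemma beta_poly_Suc: "beta_poly \<beta> (Suc k) = pCons (- beta_digit \<beta> (Suc k)) (beta_poly \<beta> k)"
proof (rule poly_eqI)
  fix n
  have "(\<Sum>i=1..k. coeff (monom (beta_digit \<beta> i) (Suc k - i)) n) =
    coeff (pCons 0 (\<Sum>i=1..k. monom (beta_digit \<beta> i) (k - i))) n"
    by (cases n) (simp_all add: coeff_sum Suc_diff_le)
  then show "coeff (beta_poly \<beta> (Suc k)) n =
    coeff (pCons (- beta_digit \<beta> (Suc k)) (beta_poly \<beta> k)) n"
    by (cases n) (simp_all add: beta_poly_def coeff_sum)
qed

text \<open>Subtracting P_1 = x - c_1 from P_8 changes only the two lowest coefficients.\<close>

lemma companion_polynomial_1_7:
  assumes "preperiod_length \<beta> = 1" and "period_length \<beta> = 7"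
  defines "c \<equiv> beta_digit \<beta>"
  shows "companion_polynomial \<beta> =
    [:c 1 - c 8, - c 7 - 1, - c 6, - c 5, - c 4, - c 3, - c 2, - c 1, 1:]"
  unfolding companion_polynomial_def assms c_def
  by (simp add: eval_nat_numeral beta_poly_Suc beta_poly_0 one_pCons)

lemma cofactor_product:
  fixes a b c :: "'a::comm_ring_1"
  shows "[:1, a, b, c, b, a, 1:] * [:1, 0, 1:] =
    [:1, a, b + 1, a + c, 2 * b, a + c, b + 1, a, 1:]"
  by (simp add: algebra_simps)

text \<open>Comparison of coefficients; these five digits suffice to read off all the
  inequalities.\<close>

lemma digits_if_cofactor:
  assumes "is_minimal_int_polynomial [:1, a, b, c, b, a, 1:] \<beta>"
    and "preperiod_length \<beta> = 1" and "period_length \<beta> = 7" and "is_cofactor [:1, 0, 1:] \<beta>"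
  shows "beta_digit \<beta> 1 = - a" "beta_digit \<beta> 2 = - b - 1" "beta_digit \<beta> 3 = - a - c"
    "beta_digit \<beta> 4 = - 2 * b" "beta_digit \<beta> 5 = - a - c"
proof -
  obtain P where "is_minimal_int_polynomial P \<beta>" "companion_polynomial \<beta> = P * [:1, 0, 1:]"
    using assms(4) by (auto simp: is_cofactor_def)
  then have "companion_polynomial \<beta> = [:1, a, b + 1, a + c, 2 * b, a + c, b + 1, a, 1:]"
    using minimal_int_polynomial_unique[OF assms(1)] cofactor_product by metis
  then show "beta_digit \<beta> 1 = - a" "beta_digit \<beta> 2 = - b - 1" "beta_digit \<beta> 3 = - a - c"
    "beta_digit \<beta> 4 = - 2 * b" "beta_digit \<beta> 5 = - a - c"
    unfolding companion_polynomial_1_7[OF assms(2,3)] by auto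
qed

text \<open>Indexed from 0, one less than \<^const>\<open>beta_digit\<close>.\<close>

definition digit_seq :: "int \<Rightarrow> int \<Rightarrow> int \<Rightarrow> nat \<Rightarrow> int" where
  "digit_seq a b c n = (if n = 0 then - a
     else [- b - 1, - a - c, - 2 * b, - a - c, - b - 1, - a - 1, - a - 1] ! ((n - 1) mod 7))"

text \<open>The greedy recursion with prescribed digits in place of floors, so that its periodicity
  is a polynomial identity in \<open>\<beta>\<close>.\<close>

fun remainder_seq :: "real \<Rightarrow> int \<Rightarrow> int \<Rightarrow> int \<Rightarrow> nat \<Rightarrow> real" where
  "remainder_seq \<beta> a b c 0 = 1"
| "remainder_seq \<beta> a b c (Suc n) = \<beta> * remainder_seq \<beta> a b c n - of_int (digit_seq a b c n)"

section \<open>Admissibility and periodicity of the candidate expansion\<close>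

lemma less_7_cases:
  fixes i :: nat
  assumes "i < 7"
  obtains "i = 0" | "i = 1" | "i = 2" | "i = 3" | "i = 4" | "i = 5" | "i = 6"
  using assms by linarith

lemma digit_seq_periodic: "digit_seq a b c (Suc n + 7 * k) = digit_seq a b c (Suc n)"
  by (simp add: digit_seq_def)

lemma digit_seq_shift: "digit_seq a b c (Suc n + j) = digit_seq a b c (Suc (n mod 7) + j)"
  by (simp add: digit_seq_def mod_add_left_eq)

text \<open>By periodicity only seven shifts matter. The leading digit \<open>- a\<close> exceeds
  every digit of the period, except that it ties with \<open>- 2 * b\<close> when
  \<open>a = 2 * b\<close>; there the condition on \<open>b + c\<close> decides.\<close>

lemma digit_seq_lex:
  assumes "b \<le> -1" "1 \<le> c" "c \<le> - a" "a \<le> 2 * b" "a = 2 * b \<longrightarrow> 1 \<le> b + c" "n \<ge> 1"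
  shows "\<exists>k. (\<forall>j<k. digit_seq a b c (n + j) = digit_seq a b c j) \<and>
    digit_seq a b c (n + k) < digit_seq a b c k"
proof -
  obtain m where n: "n = Suc m"
    using assms(6) by (cases n) auto
  let ?i = "m mod 7"
  let ?e = "digit_seq a b c"
  have "\<exists>k. (\<forall>j<k. ?e (Suc ?i + j) = ?e j) \<and> ?e (Suc ?i + k) < ?e k"
  proof (cases "?i = 2 \<and> a = 2 * b")
    case False
    have "?e (Suc ?i) < ?e 0"
      by (rule less_7_cases[of ?i]) (use assms False in \<open>simp_all add: digit_seq_def\<close>)
    then show ?thesis
      by (intro exI[of _ 0]) simp
  next
    case True
    then have i: "?i = 2"
      by simp
    show ?thesis
    \<comment> \<open>After the tie the second digits are \<open>- a - c = - 2 * b - c\<close> and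
      \<open>- b - 1\<close>: a strict drop unless \<open>b + c = 1\<close>.\<close>
    proof (cases "b + c = 1")
      case False
      with True assms show ?thesis
        unfolding i by (intro exI[of _ 1]) (simp add: digit_seq_def)
    next
      case bc: True
      \<comment> \<open>Now \<open>- a - c = - b - 1\<close>, so three digits agree, and the fourth
        comparison is \<open>- a - 1 < - 2 * b\<close>.\<close>
      have "\<forall>j<3. ?e (Suc 2 + j) = ?e j"
        using True bc by (simp add: numeral_3_eq_3 All_less_Suc digit_seq_def)
      moreover have "?e (Suc 2 + 3) < ?e 3"
        using True by (simp add: digit_seq_def)
      ultimately show ?thesis
        unfolding i by blast
    qed
  qed
  then show ?thesis
    unfolding n by (metis digit_seq_shift)
qed

text \<open>The remainders are the Horner values P_n(\<open>\<beta>\<close>), so r_8 - r_1 is the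
  companion polynomial at \<open>\<beta>\<close>, a multiple of the minimal polynomial; equal digits
  then propagate r_8 = r_1.\<close>

lemma remainder_seq_periodic:
  assumes "is_minimal_int_polynomial [:1, a, b, c, b, a, 1:] \<beta>"
  shows "remainder_seq \<beta> a b c (Suc n + 7) = remainder_seq \<beta> a b c (Suc n)"
proof (induction n)
  case 0
  have root: "1 + \<beta> * (a + \<beta> * (b + \<beta> * (c + \<beta> * (b + \<beta> * (a + \<beta>))))) = 0"
    using assms
    by (simp add: is_minimal_int_polynomial_def is_minimal_polynomial_def map_poly_pCons
        of_rat_of_int_eq)
  let ?r = "remainder_seq \<beta> a b c"
  note step = remainder_seq.simps(2)[of \<beta> a b c]
  have r1: "?r 1 = \<beta> + a"
    using step[of 0] by (simp add: digit_seq_def del: remainder_seq.simps(2))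
  have r2: "?r 2 = \<beta> * ?r 1 + b + 1"
    using step[of 1] by (simp add: digit_seq_def numeral_2_eq_2 del: remainder_seq.simps(2))
  have r3: "?r 3 = \<beta> * ?r 2 + a + c"
    using step[of 2] by (simp add: digit_seq_def numeral_2_eq_2 numeral_3_eq_3 del: remainder_seq.simps(2))
  have r4: "?r 4 = \<beta> * ?r 3 + 2 * b"
    using step[of 3] by (simp add: digit_seq_def del: remainder_seq.simps(2))
  have r5: "?r 5 = \<beta> * ?r 4 + a + c"
    using step[of 4] by (simp add: digit_seq_def del: remainder_seq.simps(2))
  have r6: "?r 6 = \<beta> * ?r 5 + b + 1"
    using step[of 5] by (simp add: digit_seq_def del: remainder_seq.simps(2))
  have r7: "?r 7 = \<beta> * ?r 6 + a + 1"
    using step[of 6] by (simp add: digit_seq_def del: remainder_seq.simps(2))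
  have r8: "?r 8 = \<beta> * ?r 7 + a + 1"
    using step[of 7] by (simp add: digit_seq_def del: remainder_seq.simps(2))
  have "?r 8 - ?r 1 =
    (\<beta>\<^sup>2 + 1) * (1 + \<beta> * (a + \<beta> * (b + \<beta> * (c + \<beta> * (b + \<beta> * (a + \<beta>))))))"
    unfolding r8 r7 r6 r5 r4 r3 r2 r1 by (simp add: algebra_simps power2_eq_square)
  then have "?r 8 = ?r 1"
    unfolding root by (simp del: remainder_seq.simps(2))
  then show ?case
    by (simp del: remainder_seq.simps(2))
next
  case (Suc n)
  let ?r = "remainder_seq \<beta> a b c"
  have "?r (Suc (Suc n) + 7) = \<beta> * ?r (Suc n + 7) - digit_seq a b c (Suc n + 7)"
    by (simp only: add_Suc remainder_seq.simps(2))
  also have "\<dots> = \<beta> * ?r (Suc n) - digit_seq a b c (Suc n)"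
    using digit_seq_periodic[of a b c n 1] by (simp only: Suc.IH mult_1_right)
  finally show ?case
    by simp
qed

lemma remainder_seq_bounded:
  assumes "is_minimal_int_polynomial [:1, a, b, c, b, a, 1:] \<beta>"
  shows "\<exists>B. \<forall>n. \<bar>remainder_seq \<beta> a b c n\<bar> \<le> B"
proof -
  let ?r = "remainder_seq \<beta> a b c"
  have "?r n \<in> ?r ` {..7}" for n
  proof (induction n rule: less_induct)
    case (less n)
    show ?case
    proof (cases "n \<le> 7")
      case False
      \<comment> \<open>Index 0 precedes the period, so the reduction by 7 must land at an index of
        at least 1.\<close>
      then have "Suc (n - 8) + 7 = n" "n - 7 = Suc (n - 8)"
        by auto
      then have "?r n = ?r (n - 7)"
        using remainder_seq_periodic[OF assms, of "n - 8"] by metis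
      then show ?thesis
        using less[of "n - 7"] False by simp
    qed auto
  qed
  then have "\<bar>?r n\<bar> \<le> Max ((\<lambda>n. \<bar>?r n\<bar>) ` {..7})" for n
    by (intro Max_ge) (auto simp: image_iff, metis)
  then show ?thesis
    by blast
qed

section \<open>Exact expansion, preperiod and period under the inequalities\<close>

lemma expansion_if_inequalities:
  assumes "is_minimal_int_polynomial [:1, a, b, c, b, a, 1:] \<beta>" and "\<beta> > 1"
    and ineqs: "b \<le> -1" "1 \<le> c" "c \<le> - a" "a \<le> 2 * b" "a = 2 * b \<longrightarrow> 1 \<le> b + c"
  shows "beta_digit \<beta> (Suc n) = digit_seq a b c n" and "beta_remainder \<beta> n \<noteq> 0"
proof -
  let ?r = "remainder_seq \<beta> a b c" and ?e = "digit_seq a b c"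
  obtain B where B: "\<And>n. \<bar>?r n\<bar> \<le> B"
    using remainder_seq_bounded[OF assms(1)] by blast
  have nonneg: "0 \<le> ?e n" for n
  proof (cases n)
    case (Suc m)
    show ?thesis
      unfolding Suc by (rule less_7_cases[of "m mod 7"]) (use ineqs in \<open>simp_all add: digit_seq_def\<close>)
  qed (use ineqs in \<open>simp add: digit_seq_def\<close>)
  \<comment> \<open>The digit \<open>- 2 * b\<close>, at least 2, recurs at the indices
    \<open>3 + 7 * n\<close>.\<close>
  have "\<exists>k\<ge>n. 0 < ?e k" for n
    using digit_seq_periodic[of a b c 2 n] ineqs by (intro exI[of _ "3 + 7 * n"]) (simp add: digit_seq_def)
  note crit = parry_criterion[OF \<open>\<beta> > 1\<close> _ _ B nonneg this digit_seq_lex[OF ineqs]]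
  have pos: "0 < ?r n" for n
    by (rule crit) simp_all
  have "?r (Suc n) < 1" for n
    by (rule crit) simp_all
  note exp = beta_expansion_unique[of ?r \<beta> ?e, OF _ _ conjI[OF less_imp_le[OF pos] this]]
  show "beta_digit \<beta> (Suc n) = ?e n"
    by (rule exp) simp_all
  have "beta_remainder \<beta> n = ?r n"
    by (rule exp) simp_all
  then show "beta_remainder \<beta> n \<noteq> 0"
    using pos[of n] by simp
qed

lemma periods_if_inequalities:
  assumes "is_minimal_int_polynomial [:1, a, b, c, b, a, 1:] \<beta>" and "\<beta> > 1"
    and ineqs: "b \<le> -1" "1 \<le> c" "c \<le> - a" "a \<le> 2 * b" "a = 2 * b \<longrightarrow> 1 \<le> b + c"
  shows "beta_periodic_from \<beta> 1 7" and "preperiod_length \<beta> = 1" and "period_length \<beta> = 7"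
proof -
  let ?e = "digit_seq a b c"
  note digit = expansion_if_inequalities(1)[OF assms]
  have periodic_iff: "beta_periodic_from \<beta> m p \<longleftrightarrow> (\<forall>n. ?e (n + m) = ?e (n + m + p))" for m p
    by (auto simp: beta_periodic_from_def digit Suc_le_eq gr0_conv_Suc)
  show per: "beta_periodic_from \<beta> 1 7"
    unfolding periodic_iff by (simp add: digit_seq_def)
  \<comment> \<open>Pure periodicity would make a proper shift equal to the sequence, contradicting
    its strict lexicographic decrease.\<close>
  have "\<not> beta_periodic_from \<beta> 0 p" if p: "p \<ge> 1" for p
  proof
    assume "beta_periodic_from \<beta> 0 p"
    then have "?e n = ?e (p + n)" for n
      by (simp add: periodic_iff add.commute)
    then show False
      using digit_seq_lex[OF ineqs p] by (metis less_irrefl)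
  qed
  then show pre: "preperiod_length \<beta> = 1"
    unfolding preperiod_length_def
    using per by (intro Least_equality) (auto simp: Suc_le_eq intro!: exI[of _ 7] intro: gr0I)
  \<comment> \<open>As 7 is prime, a block fixed by a nontrivial rotation is constant, but
    \<open>- b - 1 = - 2 * b\<close> would force \<open>b = 1\<close>.\<close>
  have "\<not> beta_periodic_from \<beta> 1 p" if "1 \<le> p" "p < 7" for p
  proof
    assume "beta_periodic_from \<beta> 1 p"
    then have e: "?e (n + 1) = ?e (n + 1 + p)" for n
      by (simp add: periodic_iff)
    show False
      using \<open>p < 7\<close>
      by (rule less_7_cases)
        (use that ineqs e[of 0] e[of 1] e[of 2] e[of 3] e[of 4] e[of 5] e[of 6] in
          \<open>simp_all add: digit_seq_def\<close>)
  qed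
  then have "(LEAST p. p \<ge> 1 \<and> beta_periodic_from \<beta> 1 p) = 7"
    using per by (intro Least_equality) (auto simp: not_less[symmetric])
  \<comment> \<open>Nonvanishing remainders exclude the conventional value 0 for finite
    expansions.\<close>
  then show "period_length \<beta> = 7"
    using expansion_if_inequalities(2)[OF assms] by (simp add: period_length_def pre)
qed

theorem proposition2p3:
  fixes \<beta> :: real and a b c :: int
  assumes "salem_number \<beta>"
    and "is_minimal_int_polynomial [:1, a, b, c, b, a, 1:] \<beta>"
  shows "\<beta> \<in> salem_parry_numbers 1 7 \<inter> salem_parry_with_cofactor [:1, 0, 1:] \<longleftrightarrow>
    b \<le> -1 \<and> (1 \<le> c \<and> c \<le> -a) \<and> a \<le> 2 * b \<and> (a = 2 * b \<longrightarrow> 1 \<le> b + c)"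
    (is "?L \<longleftrightarrow> ?R")
proof
  have "\<beta> > 1"
    using assms(1) by (simp add: salem_number_def)
  {
    assume ?L
    then have "preperiod_length \<beta> = 1" "period_length \<beta> = 7" "is_cofactor [:1, 0, 1:] \<beta>"
      by (auto simp: salem_parry_numbers_def salem_parry_with_cofactor_def)
    note d = digits_if_cofactor[OF assms(2) this]
    have "0 \<le> \<beta>"
      using \<open>\<beta> > 1\<close> by simp
    note nonneg = beta_digit_nonneg[OF this] and first = beta_digit_le_first[OF this]
      and second = beta_digit_le_second[OF this]
    have "0 \<le> - b - 1" "0 \<le> - a - c" "- a - c \<le> - a" "- 2 * b \<le> - a"
      using nonneg[of 2] nonneg[of 3] first[of 3] first[of 4] d by simp_all
    \<comment> \<open>If \<open>c = 0\<close>, the third digit equals the first, so the fourth is at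
      most the second: \<open>- 2 * b \<le> - b - 1\<close>, impossible for negative
      \<open>b\<close>.\<close>
    moreover have "c \<noteq> 0"
      using second[of 3] d \<open>0 \<le> - b - 1\<close> by auto
    \<comment> \<open>Here the fourth digit equals the first, so the fifth is at most the
      second.\<close>
    moreover have "- a - c \<le> - b - 1" if "a = 2 * b"
      using second[of 4] d that by simp
    ultimately show ?R
      by auto
  next
    assume ?R
    then have ineqs: "b \<le> -1" "1 \<le> c" "c \<le> - a" "a \<le> 2 * b" "a = 2 * b \<longrightarrow> 1 \<le> b + c"
      by auto
    note per = periods_if_inequalities[OF assms(2) \<open>\<beta> > 1\<close> ineqs]
    have digit: "beta_digit \<beta> n = digit_seq a b c (n - 1)" if "n \<ge> 1" for n
      using expansion_if_inequalities(1)[OF assms(2) \<open>\<beta> > 1\<close> ineqs, of "n - 1"] that by simp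
    \<comment> \<open>The last two digits \<open>- a - 1\<close> yield the lowest coefficients: c_1
      - c_8 = 1 and - c_7 - 1 = \<open>a\<close>.\<close>
    have "companion_polynomial \<beta> = [:1, a, b, c, b, a, 1:] * [:1, 0, 1:]"
      unfolding companion_polynomial_1_7[OF per(2,3)] cofactor_product
      by (simp add: digit digit_seq_def)
    then have "is_cofactor [:1, 0, 1:] \<beta>"
      using assms(2) by (auto simp: is_cofactor_def)
    moreover have "parry_number \<beta>"
      unfolding parry_number_def
      using per(1) \<open>\<beta> > 1\<close> by (metis one_le_numeral)
    ultimately show ?L
      using assms(1) per by (simp add: salem_parry_numbers_def salem_parry_with_cofactor_def)
  }
qed

end
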